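(* Fix $m\ge1$ and let $\{a_n\}_{n\ge0}$ be the $m$-gonal sequence. For $n\ge1$, let $Y_n$ be the number of summands in the (unique) legal $m$-gonal decomposition of an integer chosen uniformly at random from $[0,a_{mn+1})$. Then the mean $\mu_n$ and variance $\sigma_n^2$ of $Y_n$ are \[ \mu_n=\frac{mn}{m+1}+\frac12,\qquad \sigma_n^2=\frac{mn}{(m+1)^2}+\frac14, \] and $Y_n'=(Y_n-\mu_n)/\sigma_n$ converges in distribution to the standard normal distribution as $n\to\infty$.
   Context: Bins of an increasing sequence $\{a_n\}_{n\ge0}$: $b_0=[a_0]$, $b_k=[a_{m(k-1)+1},\dots,a_{mk}]$ for $k\ge1$. A legal $m$-gonal decomposition of $z$ is $z=a_{\ell_t}+\cdots+a_{\ell_1}$ with $\ell_1<\cdots<\ell_t$ and no two summands in the same bin ($0$ has the empty decomposition, with $0$ summands). The $m$-gonal sequence: each $a_i$ is the smallest positive integer with no legal $m$-gonal decomposition using only $a_0,\dots,a_{i-1}$. Every nonnegative integer has a unique legal $m$-gonal decomposition in terms of this sequence. *)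

theory Defs
  imports "HOL-Probability.Probability"
begin

text \<open>A bin is represented by the set of indices of its terms; a decomposition by the
  (automatically finite) set of indices of its summands.\<close>

fun bin :: "nat \<Rightarrow> nat \<Rightarrow> nat set" where
  "bin m 0 = {0}"
| "bin m (Suc k) = {m * k + 1..m * Suc k}"

definition legal_decomp :: "nat \<Rightarrow> (nat \<Rightarrow> nat) \<Rightarrow> nat \<Rightarrow> nat set \<Rightarrow> bool" where
  "legal_decomp m a z L \<longleftrightarrow>
     finite L \<and> z = (\<Sum>l\<in>L. a l) \<and> (\<forall>i\<in>L. \<forall>j\<in>L. \<forall>k. i \<in> bin m k \<and> j \<in> bin m k \<longrightarrow> i = j)"

text \<open>The congruence rule lets the function package see that the recursion below
  only inspects earlier terms.\<close>

lemma legal_decomp_cong [fundef_cong]: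
  assumes "m = m'" "z = z'" "L = L'" "\<And>l. l \<in> L' \<Longrightarrow> a l = a' l"
  shows "legal_decomp m a z L = legal_decomp m' a' z' L'"
  using assms by (simp add: legal_decomp_def cong: sum.cong)

context
  notes conj_cong [fundef_cong]
begin

fun gonal_seq :: "nat \<Rightarrow> nat \<Rightarrow> nat" where
  "gonal_seq m i =
     (LEAST z. 0 < z \<and> \<not> (\<exists>L. L \<subseteq> {..<i} \<and> legal_decomp m (gonal_seq m) z L))"

end

declare gonal_seq.simps [simp del]

text \<open>The definite description is harmless: for positive \<^term>\<open>m\<close> every natural number has exactly one
  legal decomposition, the empty one for 0.\<close>

definition num_summands :: "nat \<Rightarrow> nat \<Rightarrow> nat" where
  "num_summands m z = card (THE L. legal_decomp m (gonal_seq m) z L)"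

definition sample :: "nat \<Rightarrow> nat \<Rightarrow> nat pmf" where
  "sample m n = pmf_of_set {0..<gonal_seq m (m * n + 1)}"

definition Y :: "nat \<Rightarrow> nat \<Rightarrow> real" where
  "Y m z = real (num_summands m z)"

definition mean_Y :: "nat \<Rightarrow> nat \<Rightarrow> real" where
  "mean_Y m n = measure_pmf.expectation (sample m n) (Y m)"

definition variance_Y :: "nat \<Rightarrow> nat \<Rightarrow> real" where
  "variance_Y m n = measure_pmf.variance (sample m n) (Y m)"

definition normalized_Y :: "nat \<Rightarrow> nat \<Rightarrow> nat \<Rightarrow> real" where
  "normalized_Y m n z = (Y m z - mean_Y m n) / sqrt (variance_Y m n)"

end

theory Submission
  imports Defs "HOL-Real_Asymp.Real_Asymp"
begin

text \<open>The legal index sets below \<open>i + 1\<close> are those below \<open>i\<close>, together with \<open>i\<close> added to those below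
  the first index of the bin of \<open>i\<close>. Hence, if \<open>a i\<close> counts the legal sets below \<open>i\<close>, their \<open>a\<close>-sums
  fill the interval \<open>[0, a i)\<close> without repetition, and \<open>a\<close> is the \<open>m\<close>-gonal sequence. Completing a bin
  replaces the distribution of the number of summands by its convolution with a
  Bernoulli distribution of parameter \<open>m / (m + 1)\<close>; bin 0 contributes a fair coin. So \<open>Y\<close> is
  distributed as a sum of independent Bernoulli variables, whose characteristic function is
  explicit, and Levy's continuity theorem applies.\<close>

section \<open>Legal index sets\<close>

text \<open>For \<open>m >= 1\<close> this is the ceiling of \<open>i / m\<close>, the number of the
  bin containing \<open>i\<close>. Legality of a finite set then becomes injectivity of
  \<open>bin_index m\<close>.\<close>

definition bin_index :: "nat \<Rightarrow> nat \<Rightarrow> nat" where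
  "bin_index m i = (i + m - 1) div m"

fun bin_start :: "nat \<Rightarrow> nat \<Rightarrow> nat" where
  "bin_start m 0 = 0"
| "bin_start m (Suc k) = m * k + 1"

text \<open>No sequence occurs here: legality concerns indices only, so these sets can be counted
  before anything is known about the values of \<open>gonal_seq\<close>.\<close>

definition legal_sets :: "nat \<Rightarrow> nat \<Rightarrow> nat set set" where
  "legal_sets m i = {L. L \<subseteq> {..<i} \<and> inj_on (bin_index m) L}"

lemma bin_eq_bin_index:
  assumes "m \<ge> 1"
  shows "bin m k = {i. bin_index m i = k}"
proof (cases k)
  case 0
  have "(i + m - 1) div m = 0 \<longleftrightarrow> i = 0" for i
    using assms by (auto simp: div_eq_0_iff)
  then show ?thesis
    using 0 by (auto simp: bin_index_def)
next
  case (Suc l)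
  have "(i + m - 1) div m = Suc l \<longleftrightarrow> m * l + 1 \<le> i \<and> i \<le> m * Suc l" for i
  proof -
    have "(i + m - 1) div m = Suc l \<longleftrightarrow> Suc l \<le> (i + m - 1) div m \<and> (i + m - 1) div m < Suc (Suc l)"
      by linarith
    also have "\<dots> \<longleftrightarrow> Suc l * m \<le> i + m - 1 \<and> i + m - 1 < Suc (Suc l) * m"
      using assms by (simp only: less_eq_div_iff_mult_less_eq div_less_iff_less_mult)
    also have "\<dots> \<longleftrightarrow> m * l + 1 \<le> i \<and> i \<le> m * Suc l"
      using assms by (auto simp: algebra_simps)
    finally show ?thesis .
  qed
  then show ?thesis
    unfolding Suc bin.simps bin_index_def by (simp only: set_eq_iff mem_Collect_eq atLeastAtMost_iff) simp
qed

lemma legal_decomp_iff: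
  assumes "m \<ge> 1"
  shows "legal_decomp m a z L \<longleftrightarrow> finite L \<and> z = sum a L \<and> inj_on (bin_index m) L"
  using assms by (auto simp: legal_decomp_def bin_eq_bin_index inj_on_def)

lemma bin_index_in_bin:
  assumes "m \<ge> 1"
  shows "i \<in> bin m (bin_index m i)"
  using assms by (simp add: bin_eq_bin_index)

lemma bin_start_le:
  assumes "m \<ge> 1"
  shows "bin_start m (bin_index m i) \<le> i"
  using bin_index_in_bin[OF assms, of i] by (cases "bin_index m i") auto

text \<open>Bins are consecutive intervals, so an index below \<open>i\<close> outside the bin of
  \<open>i\<close> precedes that whole bin. This makes the sets that \<open>i\<close> may join again
  of the form \<open>legal_sets m _\<close>.\<close>

lemma less_bin_start_iff:
  assumes "m \<ge> 1" "j < i"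
  shows "j < bin_start m (bin_index m i) \<longleftrightarrow> bin_index m j \<noteq> bin_index m i"
proof
  assume less: "j < bin_start m (bin_index m i)"
  show "bin_index m j \<noteq> bin_index m i"
    using bin_start_le[OF assms(1), of j] less by auto
next
  assume ne: "bin_index m j \<noteq> bin_index m i"
  then have "j \<notin> bin m (bin_index m i)"
    using assms by (simp add: bin_eq_bin_index)
  then show "j < bin_start m (bin_index m i)"
    using bin_index_in_bin[OF assms(1), of i] \<open>j < i\<close> by (cases "bin_index m i") auto
qed

lemma bin_index_add:
  assumes "r < m"
  shows "bin_index m (m * k + 1 + r) = Suc k"
proof -
  have "m * k + 1 + r \<in> bin m (Suc k)"
    using assms by auto
  then show ?thesis
    using assms by (subst (asm) bin_eq_bin_index) auto
qed

lemma finite_legal_sets [simp]: "finite (legal_sets m i)"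
  unfolding legal_sets_def by (rule finite_subset[of _ "Pow {..<i}"]) auto

lemma finite_if_legal_sets: "L \<in> legal_sets m i \<Longrightarrow> finite L"
  unfolding legal_sets_def using finite_subset by auto

lemma legal_sets_0 [simp]: "legal_sets m 0 = {{}}"
  by (auto simp: legal_sets_def)

lemma legal_sets_mono: "i \<le> j \<Longrightarrow> legal_sets m i \<subseteq> legal_sets m j"
  by (auto simp: legal_sets_def)

lemma notin_legal_sets: "L \<in> legal_sets m j \<Longrightarrow> j \<le> i \<Longrightarrow> i \<notin> L"
  by (auto simp: legal_sets_def)

text \<open>Split by membership of \<open>i\<close>: any further element lies in another, hence
  earlier, bin, and conversely no index before the bin of \<open>i\<close> can clash with
  \<open>i\<close>.\<close>

lemma legal_sets_Suc:
  assumes "m \<ge> 1"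
  shows "legal_sets m (Suc i) =
           legal_sets m i \<union> insert i ` legal_sets m (bin_start m (bin_index m i))"
    (is "_ = _ \<union> insert i ` legal_sets m ?s")
proof (intro equalityI subsetI)
  fix L assume L: "L \<in> legal_sets m (Suc i)"
  show "L \<in> legal_sets m i \<union> insert i ` legal_sets m ?s"
  proof (cases "i \<in> L")
    case False
    then have "L \<in> legal_sets m i"
      using L by (auto simp: legal_sets_def less_Suc_eq)
    then show ?thesis ..
  next
    case True
    have "j < ?s" if "j \<in> L - {i}" for j
    proof -
      have "j < i" "bin_index m j \<noteq> bin_index m i"
        using that L True by (auto simp: legal_sets_def inj_on_def less_Suc_eq)
      then show ?thesis
        using assms by (simp add: less_bin_start_iff)
    qed
    then have "L - {i} \<in> legal_sets m ?s"
      using L by (auto simp: legal_sets_def inj_on_def)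
    moreover have "L = insert i (L - {i})"
      using True by auto
    ultimately show ?thesis by blast
  qed
next
  fix L assume "L \<in> legal_sets m i \<union> insert i ` legal_sets m ?s"
  then show "L \<in> legal_sets m (Suc i)"
  proof
    assume "L \<in> legal_sets m i"
    then show ?thesis using legal_sets_mono[of i "Suc i"] by auto
  next
    assume "L \<in> insert i ` legal_sets m ?s"
    then obtain L' where L': "L = insert i L'" "L' \<in> legal_sets m ?s" by auto
    have "j < i \<and> bin_index m j \<noteq> bin_index m i" if "j \<in> L'" for j
    proof -
      have "j < ?s" using that L' by (auto simp: legal_sets_def)
      then show ?thesis
        using bin_start_le[OF assms, of i] less_bin_start_iff[OF assms, of j i] by auto
    qed
    then show ?thesis
      using L' by (force simp: legal_sets_def less_Suc_eq)
  qed
qed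

lemma inj_on_insert_legal_sets: "j \<le> i \<Longrightarrow> inj_on (insert i) (legal_sets m j)"
  by (meson inj_onI insert_ident notin_legal_sets)

text \<open>Keeping \<open>f\<close> arbitrary tracks the whole distribution of cardinalities at
  once: constants give counts, \<open>k\<close> and its square give moments, and powers
  \<open>w ^ k\<close> give the generating function.\<close>

lemma sum_card_legal_sets_Suc:
  fixes f :: "nat \<Rightarrow> 'a::comm_monoid_add"
  assumes "m \<ge> 1"
  shows "(\<Sum>L\<in>legal_sets m (Suc i). f (card L)) =
           (\<Sum>L\<in>legal_sets m i. f (card L)) +
           (\<Sum>L\<in>legal_sets m (bin_start m (bin_index m i)). f (Suc (card L)))"
proof -
  let ?s = "bin_start m (bin_index m i)"
  have s: "?s \<le> i" by (rule bin_start_le[OF assms])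
  have "legal_sets m i \<inter> insert i ` legal_sets m ?s = {}"
    using notin_legal_sets[of _ m i i] by auto
  then have "(\<Sum>L\<in>legal_sets m (Suc i). f (card L)) =
        (\<Sum>L\<in>legal_sets m i. f (card L)) + (\<Sum>L\<in>insert i ` legal_sets m ?s. f (card L))"
    unfolding legal_sets_Suc[OF assms] by (subst sum.union_disjoint) auto
  also have "(\<Sum>L\<in>insert i ` legal_sets m ?s. f (card L)) =
      (\<Sum>L\<in>legal_sets m ?s. f (card (insert i L)))"
    using inj_on_insert_legal_sets[OF s] by (simp add: sum.reindex)
  also have "\<dots> = (\<Sum>L\<in>legal_sets m ?s. f (Suc (card L)))"
    using notin_legal_sets[OF _ s] finite_if_legal_sets by (intro sum.cong refl) simp
  finally show ?thesis .
qed

lemma card_legal_sets_Suc: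
  assumes "m \<ge> 1"
  shows "card (legal_sets m (Suc i)) =
           card (legal_sets m i) + card (legal_sets m (bin_start m (bin_index m i)))"
  using sum_card_legal_sets_Suc[OF assms, of "\<lambda>_. 1::nat"] by simp

lemma sum_card_legal_sets_bin:
  fixes f :: "nat \<Rightarrow> 'a::comm_semiring_1"
  assumes "m \<ge> 1"
  shows "(\<Sum>L\<in>legal_sets m (m * Suc k + 1). f (card L)) =
           (\<Sum>L\<in>legal_sets m (m * k + 1). f (card L) + of_nat m * f (Suc (card L)))"
proof -
  have "r \<le> m \<Longrightarrow> (\<Sum>L\<in>legal_sets m (m * k + 1 + r). f (card L)) =
      (\<Sum>L\<in>legal_sets m (m * k + 1). f (card L) + of_nat r * f (Suc (card L)))" for r
  proof (induction r)
    case (Suc r)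
    have "bin_start m (bin_index m (m * k + 1 + r)) = m * k + 1"
      using Suc.prems by (subst bin_index_add) auto
    then show ?case
      using Suc sum_card_legal_sets_Suc[OF assms, of f "m * k + 1 + r"]
      by (simp add: sum.distrib algebra_simps)
  qed simp
  from this[of m] show ?thesis
    by (simp add: algebra_simps)
qed

lemma sum_card_legal_sets_1:
  fixes f :: "nat \<Rightarrow> 'a::comm_monoid_add"
  assumes "m \<ge> 1"
  shows "(\<Sum>L\<in>legal_sets m 1. f (card L)) = f 0 + f 1"
proof -
  have "bin_index m 0 = 0"
    using assms by (simp add: bin_index_def)
  then show ?thesis
    using sum_card_legal_sets_Suc[OF assms, of f 0] by simp
qed

section \<open>The m-gonal sequence\<close>

text \<open>Stated for the counting function, which is only afterwards identified with
  \<open>gonal_seq\<close>. With \<open>A\<close> for the counts, the sets avoiding the last index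
  \<open>k\<close> have sums filling \<open>[0, A k)\<close>. Those containing \<open>k\<close> have
  sums filling the adjacent interval of length \<open>A s\<close>, by the hypothesis for the bin
  start \<open>s\<close> shifted by \<open>A k\<close>.\<close>

lemma bij_betw_sum_legal_sets:
  assumes "m \<ge> 1"
  shows "bij_betw (sum (\<lambda>l. card (legal_sets m l))) (legal_sets m i) {..<card (legal_sets m i)}"
proof (induction i rule: less_induct)
  case (less i)
  define A where "A = (\<lambda>l. card (legal_sets m l))"
  have IH: "bij_betw (sum A) (legal_sets m j) {..<A j}" if "j < i" for j
    using less.IH[OF that] by (simp add: A_def)
  show ?case
  proof (cases i)
    case 0
    then show ?thesis by (auto simp: bij_betw_def)
  next
    case (Suc k)
    define s where "s = bin_start m (bin_index m k)"
    have s: "s \<le> k" unfolding s_def by (rule bin_start_le[OF assms])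
    have shift: "sum A (insert k L) = A k + sum A L" if "L \<in> legal_sets m s" for L
      using notin_legal_sets[OF that s] finite_if_legal_sets[OF that] by simp
    have img: "sum A ` insert k ` legal_sets m s = (+) (A k) ` {..<A s}"
    proof -
      have "sum A ` insert k ` legal_sets m s = (\<lambda>L. A k + sum A L) ` legal_sets m s"
        unfolding image_image using shift by (rule image_cong[OF refl])
      also have "\<dots> = (+) (A k) ` (sum A ` legal_sets m s)"
        by (simp add: image_image)
      also have "sum A ` legal_sets m s = {..<A s}"
        using IH[of s] s Suc by (simp add: bij_betw_def)
      finally show ?thesis .
    qed
    have "(+) (A k) ` {..<A s} = {A k..<A k + A s}"
      using image_add_atLeastLessThan[of "A k" 0 "A s"] by (simp add: lessThan_atLeast0 add.commute)
    with img have img': "sum A ` insert k ` legal_sets m s = {A k..<A k + A s}"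
      by simp
    \<comment> \<open>Injectivity follows by counting: the image is an interval with
      \<open>A s\<close> elements, as many as there are sets.\<close>
    have "inj_on (sum A) (insert k ` legal_sets m s)"
    proof (rule eq_card_imp_inj_on)
      show "card (sum A ` insert k ` legal_sets m s) = card (insert k ` legal_sets m s)"
        unfolding img' by (simp add: card_image[OF inj_on_insert_legal_sets[OF s]] A_def)
    qed simp
    with img' have "bij_betw (sum A) (insert k ` legal_sets m s) {A k..<A k + A s}"
      by (simp add: bij_betw_def)
    with IH[of k] have "bij_betw (sum A) (legal_sets m k \<union> insert k ` legal_sets m s)
        ({..<A k} \<union> {A k..<A k + A s})"
      by (intro bij_betw_combine) (auto simp: Suc)
    moreover have "{..<A k} \<union> {A k..<A k + A s} = {..<A (Suc k)}"
      using card_legal_sets_Suc[OF assms, of k] by (auto simp: A_def s_def)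
    ultimately show ?thesis
      by (simp only: Suc A_def s_def legal_sets_Suc[OF assms, symmetric])
  qed
qed

text \<open>By induction the earlier terms are the counts, so the integers representable below
  \<open>i\<close> are exactly those less than the count for \<open>i\<close>; that count is
  therefore the least one missing.\<close>

lemma gonal_seq_eq_card:
  assumes "m \<ge> 1"
  shows "gonal_seq m i = card (legal_sets m i)"
proof (induction i rule: less_induct)
  case (less i)
  let ?A = "\<lambda>l. card (legal_sets m l)"
  have "(\<exists>L. L \<subseteq> {..<i} \<and> legal_decomp m (gonal_seq m) z L) \<longleftrightarrow> z < ?A i" for z
  proof -
    have "(\<exists>L. L \<subseteq> {..<i} \<and> legal_decomp m (gonal_seq m) z L) \<longleftrightarrow>
        (\<exists>L\<in>legal_sets m i. z = sum (gonal_seq m) L)"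
      using assms finite_subset[OF _ finite_lessThan[of i]]
      by (auto simp: legal_decomp_iff legal_sets_def)
    also have "\<dots> \<longleftrightarrow> (\<exists>L\<in>legal_sets m i. z = sum ?A L)"
    proof (rule bex_cong[OF refl])
      fix L assume "L \<in> legal_sets m i"
      then have "sum (gonal_seq m) L = sum ?A L"
        by (intro sum.cong refl less.IH) (auto simp: legal_sets_def)
      then show "z = sum (gonal_seq m) L \<longleftrightarrow> z = sum ?A L" by simp
    qed
    also have "\<dots> \<longleftrightarrow> z \<in> sum ?A ` legal_sets m i" by auto
    also have "\<dots> \<longleftrightarrow> z < ?A i"
      using bij_betw_sum_legal_sets[OF assms, of i] by (simp add: bij_betw_def)
    finally show ?thesis .
  qed
  \<comment> \<open>The empty set is always legal; hence the first missing integer is positive, as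
    the definition of the sequence demands.\<close>
  moreover have "?A i > 0"
    using card_gt_0_iff[of "legal_sets m i"] by (force simp: legal_sets_def)
  ultimately show ?case
    by (subst gonal_seq.simps) (auto intro!: Least_equality)
qed

lemma bij_betw_sum_gonal_seq:
  assumes "m \<ge> 1"
  shows "bij_betw (sum (gonal_seq m)) (legal_sets m i) {..<gonal_seq m i}"
  using bij_betw_sum_legal_sets[OF assms]
  by (simp only: gonal_seq_eq_card[OF assms, abs_def])

text \<open>Uniqueness among all finite index sets, not only those below \<open>i\<close>: both sets
  lie in \<open>legal_sets m (max i j)\<close> for a bound \<open>j\<close> of \<open>L'\<close>,
  where the sum is injective. It evaluates the definite description in
  \<open>num_summands\<close>.\<close>

lemma legal_decomp_sum_iff:
  assumes "m \<ge> 1" "L \<in> legal_sets m i"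
  shows "legal_decomp m (gonal_seq m) (sum (gonal_seq m) L) L' \<longleftrightarrow> L' = L"
proof
  assume L': "legal_decomp m (gonal_seq m) (sum (gonal_seq m) L) L'"
  then obtain j where "L' \<subseteq> {..<j}"
    using assms by (metis finite_nat_bounded legal_decomp_iff)
  then have "L' \<in> legal_sets m (max i j)"
    using L' assms by (fastforce simp: legal_decomp_iff legal_sets_def)
  moreover have "L \<in> legal_sets m (max i j)"
    using assms(2) legal_sets_mono[of i "max i j"] by auto
  moreover have "inj_on (sum (gonal_seq m)) (legal_sets m (max i j))"
    using bij_betw_sum_gonal_seq[OF assms(1)] by (simp add: bij_betw_def)
  moreover have "sum (gonal_seq m) L' = sum (gonal_seq m) L"
    using L' assms by (simp add: legal_decomp_iff)
  ultimately show "L' = L" by (simp add: inj_on_def)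
next
  assume "L' = L"
  then show "legal_decomp m (gonal_seq m) (sum (gonal_seq m) L) L'"
    using assms finite_if_legal_sets[OF assms(2)] by (simp add: legal_decomp_iff legal_sets_def)
qed

section \<open>Law of the number of summands\<close>

lemma sum_num_summands:
  assumes "m \<ge> 1"
  shows "(\<Sum>z<gonal_seq m i. f (num_summands m z)) = (\<Sum>L\<in>legal_sets m i. f (card L))"
proof -
  have "(\<Sum>z<gonal_seq m i. f (num_summands m z)) =
      (\<Sum>L\<in>legal_sets m i. f (num_summands m (sum (gonal_seq m) L)))"
    by (rule sum.reindex_bij_betw[OF bij_betw_sum_gonal_seq[OF assms], symmetric])
  also have "\<dots> = (\<Sum>L\<in>legal_sets m i. f (card L))"
    using legal_decomp_sum_iff[OF assms] by (intro sum.cong refl) (simp add: num_summands_def)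
  finally show ?thesis .
qed

text \<open>The law of the number of summands in unnormalised form: bin 0 has weights 1 and 1 for
  being skipped or used, every later bin 1 and \<open>m\<close>. All later sums are
  instances.\<close>

lemma sum_num_summands_bins:
  fixes f :: "nat \<Rightarrow> 'a::comm_semiring_1"
  assumes "m \<ge> 1"
  shows "(\<Sum>z<gonal_seq m (m * 0 + 1). f (num_summands m z)) = f 0 + f 1"
    and "(\<Sum>z<gonal_seq m (m * Suc n + 1). f (num_summands m z)) =
           (\<Sum>z<gonal_seq m (m * n + 1). f (num_summands m z) + of_nat m * f (Suc (num_summands m z)))"
  using sum_card_legal_sets_1[OF assms, of f] sum_card_legal_sets_bin[OF assms, of f n]
  by (simp_all only: sum_num_summands[OF assms, of f]
      sum_num_summands[OF assms, of "\<lambda>k. f k + of_nat m * f (Suc k)"]) simp_all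

lemma gonal_seq_bin:
  assumes "m \<ge> 1"
  shows "gonal_seq m (m * n + 1) = 2 * (m + 1) ^ n"
proof (induction n)
  case 0
  show ?case using sum_num_summands_bins(1)[OF assms, of "\<lambda>_. 1::nat"] by simp
next
  case (Suc n)
  show ?case using sum_num_summands_bins(2)[OF assms, of "\<lambda>_. 1::nat" n] Suc by simp
qed

text \<open>The generating function has one factor per bin. At \<open>w = iexp u\<close> it yields
  the characteristic function.\<close>

lemma sum_power_num_summands:
  fixes w :: "'a::comm_semiring_1"
  assumes "m \<ge> 1"
  shows "(\<Sum>z<gonal_seq m (m * n + 1). w ^ num_summands m z) = (1 + w) * (1 + of_nat m * w) ^ n"
proof (induction n)
  case 0
  show ?case using sum_num_summands_bins(1)[OF assms, of "\<lambda>k. w ^ k"] by simp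
next
  case (Suc n)
  have "(\<Sum>z<gonal_seq m (m * Suc n + 1). w ^ num_summands m z) =
      (\<Sum>z<gonal_seq m (m * n + 1). (1 + of_nat m * w) * w ^ num_summands m z)"
    using sum_num_summands_bins(2)[OF assms, of "\<lambda>k. w ^ k" n] by (simp add: algebra_simps)
  also have "\<dots> = (1 + w) * (1 + of_nat m * w) ^ Suc n"
    unfolding sum_distrib_left[symmetric] Suc by (simp add: mult_ac)
  finally show ?case .
qed

section \<open>Moments and characteristic function\<close>

lemma integral_sample:
  fixes g :: "nat \<Rightarrow> 'a::{banach, second_countable_topology}"
  assumes "m \<ge> 1"
  shows "(LINT z|measure_pmf (sample m n). g z) =
           (\<Sum>z<gonal_seq m (m * n + 1). g z) /\<^sub>R (2 * (real m + 1) ^ n)"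
proof -
  let ?N = "gonal_seq m (m * n + 1)"
  have N: "real ?N = 2 * (real m + 1) ^ n"
    unfolding gonal_seq_bin[OF assms] by (simp add: add.commute)
  have "?N > 0"
    unfolding gonal_seq_bin[OF assms] by simp
  then have ne: "{0..<?N} \<noteq> {}"
    by simp
  have "(LINT z|measure_pmf (sample m n). g z) =
      (\<Sum>z\<in>{0..<?N}. pmf (pmf_of_set {0..<?N}) z *\<^sub>R g z)"
    unfolding sample_def by (rule integral_measure_pmf) (use ne in auto)
  also have "\<dots> = (\<Sum>z\<in>{0..<?N}. (1 / real ?N) *\<^sub>R g z)"
    using ne by (intro sum.cong refl) simp
  also have "\<dots> = (\<Sum>z<?N. g z) /\<^sub>R real ?N"
    by (simp add: scaleR_sum_right lessThan_atLeast0 inverse_eq_divide)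
  finally show ?thesis
    unfolding N .
qed

text \<open>The right-hand side is arranged as the size of the sample space times the mean.\<close>

lemma sum_Y:
  assumes "m \<ge> 1"
  shows "(\<Sum>z<gonal_seq m (m * n + 1). Y m z) =
           2 * (real m + 1) ^ n * (real (m * n) / (real m + 1) + 1 / 2)"
proof (induction n)
  case 0
  show ?case using sum_num_summands_bins(1)[OF assms, of real] by (simp add: Y_def)
next
  case (Suc n)
  have "(\<Sum>z<gonal_seq m (m * Suc n + 1). Y m z) =
      (real m + 1) * (\<Sum>z<gonal_seq m (m * n + 1). Y m z) + real m * real (gonal_seq m (m * n + 1))"
    using sum_num_summands_bins(2)[OF assms, of real n]
    by (simp add: Y_def sum.distrib sum_distrib_left algebra_simps)
  also have "\<dots> = 2 * (real m + 1) ^ Suc n * (real (m * Suc n) / (real m + 1) + 1 / 2)"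
    unfolding Suc unfolding gonal_seq_bin[OF assms] by (simp add: field_simps)
  finally show ?case .
qed

text \<open>The bracket is the variance plus the squared mean. The recursion comes from expanding
  the square of \<open>k + 1\<close>, which brings in the first moment and the count.\<close>

lemma sum_Y_power2:
  assumes "m \<ge> 1"
  shows "(\<Sum>z<gonal_seq m (m * n + 1). (Y m z)\<^sup>2) =
           2 * (real m + 1) ^ n *
             (real (m * n) / (real m + 1)\<^sup>2 + 1 / 4 + (real (m * n) / (real m + 1) + 1 / 2)\<^sup>2)"
proof (induction n)
  case 0
  show ?case using sum_num_summands_bins(1)[OF assms, of "\<lambda>k. (real k)\<^sup>2"]
    by (simp add: Y_def power2_eq_square)
next
  case (Suc n)
  have "(\<Sum>z<gonal_seq m (m * Suc n + 1). (Y m z)\<^sup>2) =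
      (real m + 1) * (\<Sum>z<gonal_seq m (m * n + 1). (Y m z)\<^sup>2) +
      2 * real m * (\<Sum>z<gonal_seq m (m * n + 1). Y m z) + real m * real (gonal_seq m (m * n + 1))"
    using sum_num_summands_bins(2)[OF assms, of "\<lambda>k. (real k)\<^sup>2" n]
    by (simp add: Y_def sum.distrib sum_distrib_left algebra_simps power2_eq_square)
  also have "\<dots> = 2 * (real m + 1) ^ Suc n *
      (real (m * Suc n) / (real m + 1)\<^sup>2 + 1 / 4 + (real (m * Suc n) / (real m + 1) + 1 / 2)\<^sup>2)"
    unfolding Suc sum_Y[OF assms] unfolding gonal_seq_bin[OF assms]
    by (simp add: divide_simps) (simp add: algebra_simps power2_eq_square)
  finally show ?case .
qed

lemma mean_Y_eq:
  assumes "m \<ge> 1"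
  shows "mean_Y m n = real (m * n) / real (m + 1) + 1 / 2"
  unfolding mean_Y_def integral_sample[OF assms] sum_Y[OF assms]
  by (simp add: add.commute)

lemma variance_Y_eq:
  assumes "m \<ge> 1"
  shows "variance_Y m n = real (m * n) / (real (m + 1))\<^sup>2 + 1 / 4"
proof -
  have "finite (set_pmf (sample m n))"
    unfolding sample_def gonal_seq_bin[OF assms] by (subst set_pmf_of_set) auto
  then have int: "integrable (measure_pmf (sample m n)) g" for g :: "nat \<Rightarrow> real"
    by (rule integrable_measure_pmf_finite)
  have "variance_Y m n =
      measure_pmf.expectation (sample m n) (\<lambda>z. (Y m z)\<^sup>2) - (mean_Y m n)\<^sup>2"
    unfolding variance_Y_def mean_Y_def by (rule measure_pmf.variance_eq) (rule int)+
  moreover have "real m + 1 \<noteq> 0"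
    by linarith
  ultimately show ?thesis
    unfolding mean_Y_eq[OF assms] integral_sample[OF assms] sum_Y_power2[OF assms]
    by (simp add: add.commute flip: mult.assoc)
qed

text \<open>The characteristic function of the \<^emph>\<open>centred\<close> Bernoulli distribution.\<close>

definition bernoulli_char :: "real \<Rightarrow> real \<Rightarrow> complex" where
  "bernoulli_char p u = (1 - p) * iexp (- (u * p)) + p * iexp (u * (1 - p))"

text \<open>Here \<open>p\<close> is the probability that a bin other than bin 0 is used. The
  generating function at \<open>iexp u\<close> splits into one factor per bin, and each factor
  absorbs the part of the centring phase due to its own mean.\<close>

lemma char_normalized_Y:
  assumes "m \<ge> 1"
  defines "p \<equiv> real m / (real m + 1)"
  shows "char (distr (measure_pmf (sample m n)) borel (normalized_Y m n)) t =
           (let u = t / sqrt (variance_Y m n)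
            in bernoulli_char (1 / 2) u * bernoulli_char p u ^ n)"
proof -
  define u where "u = t / sqrt (variance_Y m n)"
  have pull: "(a * b) /\<^sub>R r = a * (b / of_real r)" for a b :: complex and r
    by (simp add: scaleR_conv_of_real divide_inverse mult_ac)
  have regroup: "a * b ^ n * (c * d ^ n / (2 * e ^ n)) = (a * (c / 2)) * (b * (d / e)) ^ n"
    for a b c d e :: complex
    by (simp add: power_mult_distrib power_divide)
  \<comment> \<open>Pulling out the centring phase leaves the uncentred Bernoulli characteristic
    function, the shape of the normalised generating factors.\<close>
  have bern: "bernoulli_char q u = iexp (- (u * q)) * (of_real (1 - q) + of_real q * iexp u)" for q
    by (simp add: bernoulli_char_def exp_add[symmetric] distrib_left right_diff_distrib mult_ac)
  have p: "1 - p = 1 / (real m + 1)"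
    by (simp add: p_def field_simps)
  have "char (distr (measure_pmf (sample m n)) borel (normalized_Y m n)) t =
      (CLINT z|measure_pmf (sample m n). iexp (t * normalized_Y m n z))"
    unfolding char_def by (subst integral_distr) auto
  also have "\<dots> = (CLINT z|measure_pmf (sample m n).
      iexp (- (u * mean_Y m n)) * iexp u ^ num_summands m z)"
  proof (rule Bochner_Integration.integral_cong[OF refl])
    fix z
    have "t * normalized_Y m n z = u * Y m z - u * mean_Y m n"
      by (simp add: normalized_Y_def u_def diff_divide_distrib algebra_simps)
    then have "iexp (t * normalized_Y m n z) = iexp (u * Y m z - u * mean_Y m n)"
      by (simp only:)
    also have "\<dots> = iexp (- (u * mean_Y m n)) * iexp u ^ num_summands m z"
      by (simp add: Y_def exp_of_nat_mult[symmetric] exp_add[symmetric] algebra_simps)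
    finally show "iexp (t * normalized_Y m n z) =
        iexp (- (u * mean_Y m n)) * iexp u ^ num_summands m z" .
  qed
  also have "\<dots> = iexp (- (u * mean_Y m n)) *
      ((1 + iexp u) * (1 + of_nat m * iexp u) ^ n / of_real (2 * (real m + 1) ^ n))"
    unfolding integral_sample[OF assms(1)] sum_distrib_left[symmetric]
      sum_power_num_summands[OF assms(1)] pull by (rule refl)
  also have "of_real (2 * (real m + 1) ^ n) = 2 * (of_nat m + 1 :: complex) ^ n"
    by simp
  \<comment> \<open>The mean is \<open>1 / 2 + n * p\<close>, so the phase is a product with one
    factor for bin 0 and \<open>n\<close> equal ones for the others.\<close>
  also have "iexp (- (u * mean_Y m n)) = iexp (- (u * (1 / 2))) * iexp (- (u * p)) ^ n"
  proof -
    have "- (u * mean_Y m n) = - (u * (1 / 2)) + real n * (- (u * p))"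
      unfolding mean_Y_eq[OF assms(1)] p_def by (simp add: algebra_simps)
    then show ?thesis
      by (simp only: of_real_add of_real_mult distrib_left exp_add exp_of_nat_mult
          of_real_of_nat_eq mult.left_commute[of \<i> "of_nat n"])
  qed
  also have "iexp (- (u * (1 / 2))) * iexp (- (u * p)) ^ n *
      ((1 + iexp u) * (1 + of_nat m * iexp u) ^ n / (2 * (of_nat m + 1) ^ n)) =
      (iexp (- (u * (1 / 2))) * ((1 + iexp u) / 2)) *
      (iexp (- (u * p)) * ((1 + of_nat m * iexp u) / (of_nat m + 1))) ^ n"
    by (rule regroup)
  also have "(1 + iexp u) / 2 = of_real (1 - 1 / 2) + of_real (1 / 2) * iexp u"
    by (simp add: field_simps)
  also have "(1 + of_nat m * iexp u) / (of_nat m + 1) = of_real (1 - p) + of_real p * iexp u"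
    unfolding p by (simp add: p_def add_divide_distrib)
  finally show ?thesis
    by (simp only: bern Let_def flip: u_def)
qed

section \<open>The Gaussian limit\<close>

text \<open>A convex combination of two numbers of modulus 1.\<close>

lemma norm_bernoulli_char_le:
  assumes "0 \<le> p" "p \<le> 1"
  shows "norm (bernoulli_char p u) \<le> 1"
proof -
  have "norm (bernoulli_char p u) \<le>
      norm (of_real (1 - p) * iexp (- (u * p))) + norm (of_real p * iexp (u * (1 - p)))"
    unfolding bernoulli_char_def using norm_triangle_ineq by fastforce
  also have "\<dots> = (1 - p) + p"
    unfolding norm_mult norm_exp_i_times norm_of_real using assms by simp
  finally show ?thesis by simp
qed

text \<open>Second-order Taylor expansion of both exponentials: centring cancels the linear terms,
  and the quadratic coefficients combine to the variance \<open>p * (1 - p)\<close>. The remainders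
  are cubic, with arguments at most \<open>\<bar>u\<bar>\<close> in modulus.\<close>

lemma bernoulli_char_approx:
  assumes "0 \<le> p" "p \<le> 1"
  shows "norm (bernoulli_char p u - of_real (1 - p * (1 - p) * u\<^sup>2 / 2)) \<le> \<bar>u\<bar> ^ 3"
proof -
  define R where "R x = iexp x - (1 + \<i> * of_real x - (of_real x)\<^sup>2 / 2)" for x
  have R: "norm (R x) \<le> \<bar>u\<bar> ^ 3" if "\<bar>x\<bar> \<le> \<bar>u\<bar>" for x
  proof -
    have "norm (R x) \<le> \<bar>x\<bar> ^ 3 / 6"
      using iexp_approx1[of x 2]
      by (simp add: R_def numeral_2_eq_2 numeral_3_eq_3 power_mult_distrib algebra_simps)
    also have "\<dots> \<le> \<bar>x\<bar> ^ 3" by simp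
    also have "\<dots> \<le> \<bar>u\<bar> ^ 3" using that by (intro power_mono) auto
    finally show ?thesis .
  qed
  have "bernoulli_char p u - of_real (1 - p * (1 - p) * u\<^sup>2 / 2) =
      of_real (1 - p) * R (- (u * p)) + of_real p * R (u * (1 - p))"
    by (simp add: bernoulli_char_def R_def field_simps power2_eq_square)
  also have "norm \<dots> \<le> (1 - p) * norm (R (- (u * p))) + p * norm (R (u * (1 - p)))"
    by (rule order_trans[OF norm_triangle_ineq])
      (use assms in \<open>simp only: norm_mult norm_of_real abs_of_nonneg diff_ge_0_iff_ge order_refl\<close>)
  also have "\<dots> \<le> (1 - p) * \<bar>u\<bar> ^ 3 + p * \<bar>u\<bar> ^ 3"
    using assms
    by (intro add_mono mult_left_mono R) (auto simp: abs_mult mult_left_le)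
  finally show ?thesis by (simp add: algebra_simps)
qed

text \<open>The constant \<open>c\<close> leaves room for the variance of bin 0. The power is
  compared with that of the quadratic Taylor polynomial \<open>w n\<close>, whose
  \<open>n\<close>-th power has the Gaussian limit. The error is at most
  \<open>n * \<bar>u n\<bar> ^ 3\<close>, of order \<open>1 / sqrt n\<close>.\<close>

lemma bernoulli_char_power_tendsto:
  fixes p t c :: real
  assumes "0 < p" "p < 1" "c > 0"
  defines "u \<equiv> \<lambda>n. t / sqrt (p * (1 - p) * real n + c)"
  shows "(\<lambda>n. bernoulli_char p (u n) ^ n) \<longlonglongrightarrow> of_real (exp (- (t\<^sup>2) / 2))"
proof -
  define v where "v = p * (1 - p)"
  have v: "v > 0" using assms by (simp add: v_def)
  define w where "w = (\<lambda>n. 1 - v * (u n)\<^sup>2 / 2)"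
  define b where "b = t\<^sup>2"
  have u2: "(u n)\<^sup>2 = b / (v * real n + c)" for n
    using v \<open>c > 0\<close> by (simp add: u_def v_def b_def power_divide)
  \<comment> \<open>The estimate \<open>norm_power_diff\<close> needs both bases in the closed unit
    disc. For \<open>w n\<close> this holds only eventually, once the quadratic term is
    small.\<close>
  have "w \<longlonglongrightarrow> 1"
    unfolding w_def u2 using v by real_asymp
  then have "eventually (\<lambda>n. w n > -1) sequentially"
    by (rule order_tendstoD) simp
  moreover have "w n \<le> 1" for n
    using v by (simp add: w_def)
  ultimately have "eventually (\<lambda>n. \<bar>w n\<bar> \<le> 1) sequentially"
    by (auto elim!: eventually_mono simp: abs_le_iff)
  then have bound: "eventually (\<lambda>n. norm (bernoulli_char p (u n) ^ n - of_real (w n) ^ n) \<le>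
      real n * \<bar>u n\<bar> ^ 3) sequentially"
  proof eventually_elim
    case (elim n)
    have "norm (bernoulli_char p (u n) ^ n - of_real (w n) ^ n) \<le>
        real n * norm (bernoulli_char p (u n) - of_real (w n))"
      using assms elim by (intro norm_power_diff norm_bernoulli_char_le) auto
    also have "\<dots> \<le> real n * \<bar>u n\<bar> ^ 3"
      using bernoulli_char_approx[of p "u n"] assms
      by (intro mult_left_mono) (auto simp: w_def v_def)
    finally show ?case .
  qed
  have "(\<lambda>n. real n * \<bar>u n\<bar> ^ 3) = (\<lambda>n. \<bar>t\<bar> ^ 3 * (real n / sqrt (v * real n + c) ^ 3))"
    using v \<open>c > 0\<close> by (auto simp: u_def v_def abs_divide power_divide)
  moreover have "(\<lambda>n. real n / sqrt (v * real n + c) ^ 3) \<longlonglongrightarrow> 0"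
    using v by real_asymp
  then have "(\<lambda>n. \<bar>t\<bar> ^ 3 * (real n / sqrt (v * real n + c) ^ 3)) \<longlonglongrightarrow> 0"
    by (rule tendsto_mult_right_zero)
  ultimately have "(\<lambda>n. real n * \<bar>u n\<bar> ^ 3) \<longlonglongrightarrow> 0"
    by (simp only:)
  with bound have "(\<lambda>n. bernoulli_char p (u n) ^ n - of_real (w n) ^ n) \<longlonglongrightarrow> 0"
    by (rule Lim_null_comparison)
  moreover have "(\<lambda>n. w n ^ n) \<longlonglongrightarrow> exp (- b / 2)"
    unfolding w_def u2 using v by real_asymp
  then have "(\<lambda>n. of_real (w n) ^ n :: complex) \<longlonglongrightarrow> of_real (exp (- b / 2))"
    unfolding of_real_power[symmetric] by (rule tendsto_of_real)
  ultimately show ?thesis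
    unfolding b_def by (rule Lim_transform[rotated])
qed

theorem theorem1p6:
  fixes m :: nat
  assumes "m \<ge> 1"
  shows "(\<forall>n\<ge>1. mean_Y m n = real (m * n) / real (m + 1) + 1 / 2 \<and>
                 variance_Y m n = real (m * n) / (real (m + 1))\<^sup>2 + 1 / 4) \<and>
         weak_conv_m (\<lambda>n. distr (measure_pmf (sample m n)) borel (normalized_Y m n))
           std_normal_distribution"
proof
  show "\<forall>n\<ge>1. mean_Y m n = real (m * n) / real (m + 1) + 1 / 2 \<and>
                 variance_Y m n = real (m * n) / (real (m + 1))\<^sup>2 + 1 / 4"
    using mean_Y_eq[OF assms] variance_Y_eq[OF assms] by blast
  show "weak_conv_m (\<lambda>n. distr (measure_pmf (sample m n)) borel (normalized_Y m n))
           std_normal_distribution"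
  proof (rule levy_continuity)
    show "real_distribution (distr (measure_pmf (sample m n)) borel (normalized_Y m n))" for n
      by (rule prob_space.real_distribution_distr[OF prob_space_measure_pmf]) simp
    show "real_distribution std_normal_distribution"
      by (rule real_dist_normal_dist)
    fix t
    define p where "p = real m / (real m + 1)"
    have p: "0 < p" "p < 1"
      using assms by (auto simp: p_def)
    define u where "u = (\<lambda>n. t / sqrt (p * (1 - p) * real n + 1 / 4))"
    \<comment> \<open>Each of the \<open>n\<close> later bins contributes
      \<open>p * (1 - p)\<close>, and the fair coin of bin 0 contributes
      \<open>1 / 4\<close>.\<close>
    have "variance_Y m n = p * (1 - p) * real n + 1 / 4" for n
      unfolding variance_Y_eq[OF assms] by (simp add: p_def field_simps power2_eq_square)
    then have char: "char (distr (measure_pmf (sample m n)) borel (normalized_Y m n)) t =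
        bernoulli_char (1 / 2) (u n) * bernoulli_char p (u n) ^ n" for n
      using char_normalized_Y[OF assms, of n t] by (simp add: Let_def u_def p_def)
    have "p * (1 - p) > 0" using p by simp
    moreover have "(\<lambda>n. 1 / sqrt (v * real n + 1 / 4)) \<longlonglongrightarrow> 0" if "v > 0" for v :: real
      using that by real_asymp
    ultimately have "(\<lambda>n. 1 / sqrt (p * (1 - p) * real n + 1 / 4)) \<longlonglongrightarrow> 0"
      by blast
    from tendsto_mult_right_zero[OF this, of t] have "u \<longlonglongrightarrow> 0"
      by (simp add: u_def)
    \<comment> \<open>Bin 0 enters as a single factor rather than an \<open>n\<close>-th power, so
      continuity suffices: as \<open>u\<close> tends to 0, the factor tends to its value 1 at
      0.\<close>
    moreover have "isCont (bernoulli_char (1 / 2)) 0"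
      unfolding bernoulli_char_def by (intro continuous_intros)
    ultimately have "(\<lambda>n. bernoulli_char (1 / 2) (u n)) \<longlonglongrightarrow> bernoulli_char (1 / 2) 0"
      by (rule isCont_tendsto_compose[rotated])
    moreover have "(\<lambda>n. bernoulli_char p (u n) ^ n) \<longlonglongrightarrow> of_real (exp (- (t\<^sup>2) / 2))"
      unfolding u_def by (rule bernoulli_char_power_tendsto) (use p in auto)
    ultimately have "(\<lambda>n. bernoulli_char (1 / 2) (u n) * bernoulli_char p (u n) ^ n)
        \<longlonglongrightarrow> bernoulli_char (1 / 2) 0 * of_real (exp (- (t\<^sup>2) / 2))"
      by (rule tendsto_mult)
    then show "(\<lambda>n. char (distr (measure_pmf (sample m n)) borel (normalized_Y m n)) t)
        \<longlonglongrightarrow> char std_normal_distribution t"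
      by (simp add: char char_std_normal_distribution bernoulli_char_def)
  qed
qed

end
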